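(* Let $F$ be a propositional logic formula in XNF involving $n$ logical variables $X_1,\dots,X_n$. Then the procedure XNFto2XNF (described in the context), applied to $F$, terminates after finitely many steps and returns a propositional logic formula $G$ in 2-XNF, in variables $X_1,\dots,X_n,Y_1,\dots,Y_m$ for some $m\ge 0$, such that $\mathcal{S}(F)\equiv_n \mathcal{S}(G)$.
   Context: A lineral is a formula $L_1\oplus L_2\oplus\cdots\oplus L_m$ (XOR) with literals $L_1,\dots,L_m$; the negation of a lineral is again (equivalent to) a lineral, since $\lnot(L_1\oplus L_2\oplus\cdots\oplus L_m)\equiv \lnot L_1\oplus L_2\oplus\cdots\oplus L_m$. An XNF clause is a disjunction of linerals. A formula is in XNF (XOR-OR-AND normal form) if it is a conjunction of XNF clauses, and in $k$-XNF if moreover every XNF clause involves at most $k$ linerals. Identify true with $1$ and false with $0$. For a formula $H$ in variables $Z_1,\dots,Z_N$, $\mathcal{S}(H)\subseteq\mathbb{F}_2^N$ denotes its set of satisfying assignments. For $S\subseteq\mathbb{F}_2^n$ and $T\subseteq\mathbb{F}_2^{n+m}$ write $S\equiv_n T$ if the projection $\pi:\mathbb{F}_2^{n+m}\to\mathbb{F}_2^n$, $(a_1,\dots,a_{n+m})\mapsto(a_1,\dots,a_n)$, restricts to a bijection $T\to S$. Procedure XNFto2XNF. Input: $F=\bigwedge_{k=1}^r C_k$ with XNF clauses $C_k$. Start with $i=0$ and $M=\emptyset$. For $k=1,\dots,r$: while $C_k$ contains more than two linerals, write $C_k=\bigvee_{j=1}^s L_j$ with linerals $L_j$, increase $i$ by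 $1$, let $Y_i$ be a new variable, replace $C_k$ by $Y_i\lor\bigvee_{j=3}^s L_j$, and adjoin the two clauses $(Y_i\lor\lnot L_2)$ and $(\lnot(Y_i\oplus L_1)\lor L_2)$ to $M$; when the while-loop ends, append $C_k$ to $M$. Finally return $\bigwedge M$ (the conjunction of all clauses in $M$). *)

theory Defs
  imports "HOL-Library.Z2" "HOL-Library.While_Combinator"
begin

text \<open>
  The input variables are \<open>X 1, \<dots>, X n\<close>; the variables \<open>Y 1, Y 2, \<dots>\<close> are reserved for
  the conversion procedure, so a \<open>Y i\<close> is new with respect to every formula in the
  \<open>X\<close>-variables.
\<close>

datatype var = X nat | Y nat

datatype 'v literal = Pos 'v | Neg 'v

text \<open>
  Linerals are XORs, clauses are disjunctions and formulas are conjunctions of the entries of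
  a list.  An XOR has at least one literal (see \<open>is_xnf\<close>); the empty disjunction (false) and
  the empty conjunction (true) are allowed.
\<close>

type_synonym 'v lineral = "'v literal list"
type_synonym 'v clause = "'v lineral list"
type_synonym 'v xnf = "'v clause list"

definition is_xnf :: "'v xnf \<Rightarrow> bool" where
  "is_xnf F \<longleftrightarrow> (\<forall>C\<in>set F. \<forall>L\<in>set C. L \<noteq> [])"

definition is_k_xnf :: "nat \<Rightarrow> 'v xnf \<Rightarrow> bool" where
  "is_k_xnf k F \<longleftrightarrow> is_xnf F \<and> (\<forall>C\<in>set F. length C \<le> k)"

definition vars :: "'v xnf \<Rightarrow> 'v set" where
  "vars F = (\<Union>C\<in>set F. \<Union>L\<in>set C. \<Union>l\<in>set L. set_literal l)"

primrec lit_val :: "('v \<Rightarrow> bit) \<Rightarrow> 'v literal \<Rightarrow> bit" where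
  "lit_val \<nu> (Pos v) = \<nu> v"
| "lit_val \<nu> (Neg v) = 1 + \<nu> v"

definition lineral_val :: "('v \<Rightarrow> bit) \<Rightarrow> 'v lineral \<Rightarrow> bit" where
  "lineral_val \<nu> L = (\<Sum>l\<leftarrow>L. lit_val \<nu> l)"

definition satisfies :: "('v \<Rightarrow> bit) \<Rightarrow> 'v xnf \<Rightarrow> bool" where
  "satisfies \<nu> F \<longleftrightarrow> (\<forall>C\<in>set F. \<exists>L\<in>set C. lineral_val \<nu> L = 1)"

text \<open>
  Points of \<open>\<bbbF>\<^sub>2\<^sup>N\<close> are lists of length \<open>N\<close> over \<^typ>\<open>bit\<close>.  The list \<open>Zs\<close> of
  (distinct) variables fixes the order of the coordinates: the \<open>j\<close>-th variable takes the value
  of the \<open>j\<close>-th coordinate.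
\<close>

definition sat_set :: "'v list \<Rightarrow> 'v xnf \<Rightarrow> bit list set" where
  "sat_set Zs H =
     {a. length a = length Zs \<and> satisfies (\<lambda>z. the (map_of (zip Zs a) z)) H}"

definition proj_equiv :: "nat \<Rightarrow> bit list set \<Rightarrow> bit list set \<Rightarrow> bool" where
  "proj_equiv n S T \<longleftrightarrow> bij_betw (take n) T S"

primrec neg_literal :: "'v literal \<Rightarrow> 'v literal" where
  "neg_literal (Pos v) = Neg v"
| "neg_literal (Neg v) = Pos v"

text \<open>\<open>\<not>(L\<^sub>1 \<oplus> L\<^sub>2 \<oplus> \<dots> \<oplus> L\<^sub>m)\<close> is represented by \<open>\<not>L\<^sub>1 \<oplus> L\<^sub>2 \<oplus> \<dots> \<oplus> L\<^sub>m\<close>.\<close>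

definition neg_lineral :: "'v lineral \<Rightarrow> 'v lineral" where
  "neg_lineral L = neg_literal (hd L) # tl L"

lemma lineral_val_neg_lineral:
  "L \<noteq> [] \<Longrightarrow> lineral_val \<nu> (neg_lineral L) = 1 + lineral_val \<nu> L"
  by (cases L; cases "hd L") (auto simp: lineral_val_def neg_lineral_def)

text \<open>
  The loops below act on the counter \<open>i\<close>, the current clause \<open>C\<close> and the list \<open>M\<close> of
  clauses collected so far.  The value \<^term>\<open>None\<close> stands for nontermination, which
  \<^const>\<open>while_option\<close> returns exactly when its loop runs forever.
\<close>

definition split_step :: "nat \<times> var clause \<times> var xnf \<Rightarrow> nat \<times> var clause \<times> var xnf" where
  "split_step = (\<lambda>(i, C, M).
     let L1 = C ! 0; L2 = C ! 1; i' = i + 1; y = Pos (Y i')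
     in (i', [y] # drop 2 C,
         M @ [[[y], neg_lineral L2], [neg_lineral (y # L1), L2]]))"

definition process_clause :: "var clause \<Rightarrow> nat \<times> var xnf \<Rightarrow> (nat \<times> var xnf) option" where
  "process_clause C = (\<lambda>(i, M).
     map_option (\<lambda>(i', C', M'). (i', M' @ [C']))
       (while_option (\<lambda>(i, C, M). length C > 2) split_step (i, C, M)))"

primrec process_clauses :: "var xnf \<Rightarrow> nat \<times> var xnf \<Rightarrow> (nat \<times> var xnf) option" where
  "process_clauses [] s = Some s"
| "process_clauses (C # Cs) s = Option.bind (process_clause C s) (process_clauses Cs)"

definition XNFto2XNF :: "var xnf \<Rightarrow> var xnf option" where
  "XNFto2XNF F = map_option snd (process_clauses F (0, []))"

end

theory Submission
  imports Defs
begin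

text \<open>
  The two clauses \<open>y \<or> \<not>L\<^sub>2\<close> and \<open>\<not>(y \<oplus> L\<^sub>1) \<or> L\<^sub>2\<close> do not force \<open>y = L\<^sub>2\<close>: if \<open>L\<^sub>2\<close> is true they
  say that \<open>y\<close> is true, and if \<open>L\<^sub>2\<close> is false they say that \<open>y\<close> equals \<open>L\<^sub>1\<close>.  Together they
  define \<open>y\<close> as \<open>L\<^sub>1 \<or> L\<^sub>2\<close>, so every solution extends uniquely to the new variable.  Extensions
  with unique extension of solutions compose, and each step shortens the current clause.
\<close>

section \<open>Values of linerals and their dependence on variables\<close>

lemma lineral_val_Nil [simp]: "lineral_val \<nu> [] = 0"
  by (simp add: lineral_val_def)

lemma lineral_val_Cons [simp]: "lineral_val \<nu> (l # L) = lit_val \<nu> l + lineral_val \<nu> L"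
  by (simp add: lineral_val_def)

lemma lit_val_cong: "(\<And>z. z \<in> set_literal l \<Longrightarrow> \<nu> z = \<mu> z) \<Longrightarrow> lit_val \<nu> l = lit_val \<mu> l"
  by (cases l) auto

lemma lineral_val_cong:
  "(\<And>l z. l \<in> set L \<Longrightarrow> z \<in> set_literal l \<Longrightarrow> \<nu> z = \<mu> z) \<Longrightarrow> lineral_val \<nu> L = lineral_val \<mu> L"
proof (induction L)
  case (Cons l L)
  have "lit_val \<nu> l = lit_val \<mu> l"
    using Cons.prems by (intro lit_val_cong) auto
  moreover have "lineral_val \<nu> L = lineral_val \<mu> L"
    using Cons.prems by (intro Cons.IH) auto
  ultimately show ?case by simp
qed simp

lemma satisfies_cong:
  assumes "\<And>z. z \<in> vars F \<Longrightarrow> \<nu> z = \<mu> z"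
  shows "satisfies \<nu> F \<longleftrightarrow> satisfies \<mu> F"
proof -
  have "lineral_val \<nu> L = lineral_val \<mu> L" if "C \<in> set F" "L \<in> set C" for C L
    using that assms by (intro lineral_val_cong) (auto simp: vars_def)
  then show ?thesis by (auto simp: satisfies_def)
qed

lemma vars_Cons: "vars (C # F) = (\<Union>L\<in>set C. \<Union>l\<in>set L. set_literal l) \<union> vars F"
  by (simp add: vars_def)

lemma vars_append [simp]: "vars (F @ G) = vars F \<union> vars G"
  by (simp add: vars_def)

lemma set_literal_neg_literal [simp]: "set_literal (neg_literal l) = set_literal l"
  by (cases l) auto

lemma vars_neg_lineral:
  "L \<noteq> [] \<Longrightarrow> (\<Union>l\<in>set (neg_lineral L). set_literal l) = (\<Union>l\<in>set L. set_literal l)"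
  by (cases L) (auto simp: neg_lineral_def)

lemma neg_lineral_neq_Nil [simp]: "neg_lineral L \<noteq> []"
  by (simp add: neg_lineral_def)

text \<open>A counterpart of \<open>proj_equiv\<close> on total assignments: the last three
  conjuncts are soundness, existence and uniqueness of extensions. Points over \<open>V\<close> and
  over \<open>W\<close> are both assignments here, so projecting is simply comparing values on
  \<open>V\<close>. Uniqueness is asked only on \<open>W\<close>, since values elsewhere are
  arbitrary.\<close>

definition unique_ext :: "'v set \<Rightarrow> 'v xnf \<Rightarrow> 'v set \<Rightarrow> 'v xnf \<Rightarrow> bool" where
  "unique_ext V F W G \<longleftrightarrow> vars F \<subseteq> V \<and> vars G \<subseteq> W \<and> V \<subseteq> W
    \<and> (\<forall>\<nu>. satisfies \<nu> G \<longrightarrow> satisfies \<nu> F)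
    \<and> (\<forall>\<nu>. satisfies \<nu> F \<longrightarrow> (\<exists>\<mu>. satisfies \<mu> G \<and> (\<forall>z\<in>V. \<mu> z = \<nu> z)))
    \<and> (\<forall>\<nu> \<mu>. satisfies \<nu> G \<longrightarrow> satisfies \<mu> G \<longrightarrow> (\<forall>z\<in>V. \<nu> z = \<mu> z) \<longrightarrow> (\<forall>z\<in>W. \<nu> z = \<mu> z))"

text \<open>Satisfaction sees only the set of clauses. Besides reflexivity, this is the tool for
  reordering clause lists.\<close>

lemma unique_ext_refl:
  assumes "vars F \<subseteq> V" and "set F = set G"
  shows "unique_ext V F V G"
proof -
  have "vars G = vars F" "\<And>\<nu>. satisfies \<nu> G = satisfies \<nu> F"
    using assms(2) by (simp_all add: vars_def satisfies_def)
  then show ?thesis using assms(1) by (auto simp: unique_ext_def)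
qed

lemma unique_ext_trans:
  assumes FG: "unique_ext U F V G" and GH: "unique_ext V G W H"
  shows "unique_ext U F W H"
  unfolding unique_ext_def
proof (intro conjI allI impI)
  show "vars F \<subseteq> U" "vars H \<subseteq> W" "U \<subseteq> W"
    using FG GH by (auto simp: unique_ext_def)
  show "satisfies \<nu> F" if "satisfies \<nu> H" for \<nu>
    using FG GH that by (simp add: unique_ext_def)
  show "\<exists>\<mu>. satisfies \<mu> H \<and> (\<forall>z\<in>U. \<mu> z = \<nu> z)" if F: "satisfies \<nu> F" for \<nu>
  proof -
    obtain \<rho> where \<rho>: "satisfies \<rho> G" "\<forall>z\<in>U. \<rho> z = \<nu> z"
      using FG F unfolding unique_ext_def by blast
    obtain \<mu> where "satisfies \<mu> H" "\<forall>z\<in>V. \<mu> z = \<rho> z"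
      using GH \<rho>(1) unfolding unique_ext_def by blast
    moreover have "U \<subseteq> V" using FG by (simp add: unique_ext_def)
    ultimately show ?thesis using \<rho>(2) by (metis subsetD)
  qed
  show "\<forall>z\<in>W. \<nu> z = \<mu> z"
    if H: "satisfies \<nu> H" "satisfies \<mu> H" and eq: "\<forall>z\<in>U. \<nu> z = \<mu> z" for \<nu> \<mu>
  proof -
    have "satisfies \<nu> G" "satisfies \<mu> G"
      using GH H by (simp_all add: unique_ext_def)
    then have "\<forall>z\<in>V. \<nu> z = \<mu> z"
      using FG eq unfolding unique_ext_def by blast
    then show ?thesis using GH H unfolding unique_ext_def by blast
  qed
qed

text \<open>\<open>L2 \<noteq> []\<close> makes \<open>neg_lineral L2\<close> a genuine negation; in
  the other clause the head \<open>Pos y\<close> is the literal that gets negated.\<close>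

lemma split_clauses_iff:
  assumes "L2 \<noteq> []"
  shows "satisfies \<nu> [[[Pos y], neg_lineral L2], [neg_lineral (Pos y # L1), L2]]
    \<longleftrightarrow> \<nu> y = (if lineral_val \<nu> L1 = 1 \<or> lineral_val \<nu> L2 = 1 then 1 else 0)"
  using assms
  by (cases "\<nu> y"; cases "lineral_val \<nu> L1"; cases "lineral_val \<nu> L2")
    (simp_all add: satisfies_def lineral_val_neg_lineral)

text \<open>Once \<open>y\<close> carries the truth value of the disjunction of \<open>L1\<close>
  and \<open>L2\<close>, the shortened clause says the same as the original one. Since
  \<open>y\<close> lies outside \<open>V\<close>, setting it to that value disturbs nothing in
  \<open>F\<close>.\<close>

lemma unique_ext_split:
  assumes y: "y \<notin> V" and V: "vars ((L1 # L2 # Ls) # F) \<subseteq> V" and ne: "L2 \<noteq> []"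
  shows "unique_ext V ((L1 # L2 # Ls) # F) (insert y V)
    (([Pos y] # Ls) # [[Pos y], neg_lineral L2] # [neg_lineral (Pos y # L1), L2] # F)"
    (is "unique_ext V ?F _ ?G")
proof -
  \<comment> \<open>\<open>d\<close> is the value forced on \<open>y\<close>; by the next fact it is
    determined by the values on \<open>V\<close>.\<close>
  define d where "d \<nu> = (if lineral_val \<nu> L1 = 1 \<or> lineral_val \<nu> L2 = 1 then 1 else 0 :: bit)"
    for \<nu>
  have d: "d \<nu> = d \<mu>" if "\<forall>z\<in>V. \<nu> z = \<mu> z" for \<nu> \<mu>
  proof -
    have "lineral_val \<nu> L1 = lineral_val \<mu> L1" "lineral_val \<nu> L2 = lineral_val \<mu> L2"
      using V that by (auto simp: vars_Cons intro!: lineral_val_cong)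
    then show ?thesis by (simp add: d_def)
  qed
  have G: "satisfies \<nu> ?G \<longleftrightarrow> \<nu> y = d \<nu> \<and> satisfies \<nu> ?F" for \<nu>
    using split_clauses_iff[OF ne, of \<nu> y L1] by (auto simp: satisfies_def d_def)
  show ?thesis
    unfolding unique_ext_def
  proof (intro conjI allI impI)
    show "vars ?F \<subseteq> V" "V \<subseteq> insert y V" using V by auto
    show "vars ?G \<subseteq> insert y V"
      using V vars_neg_lineral[OF ne] vars_neg_lineral[of "Pos y # L1"]
      by (simp add: vars_Cons) blast
    show "satisfies \<nu> ?F" if "satisfies \<nu> ?G" for \<nu>
      using that G by blast
    show "\<exists>\<mu>. satisfies \<mu> ?G \<and> (\<forall>z\<in>V. \<mu> z = \<nu> z)" if F: "satisfies \<nu> ?F" for \<nu>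
    proof -
      define \<mu> where "\<mu> = \<nu>(y := d \<nu>)"
      have \<mu>: "\<forall>z\<in>V. \<mu> z = \<nu> z" using y by (auto simp: \<mu>_def)
      then have "satisfies \<mu> ?F"
        using F V satisfies_cong[of ?F \<mu> \<nu>] by blast
      moreover have "\<mu> y = d \<mu>" unfolding d[OF \<mu>] by (simp add: \<mu>_def)
      ultimately show ?thesis using \<mu> G by blast
    qed
    show "\<forall>z\<in>insert y V. \<nu> z = \<mu> z"
      if "satisfies \<nu> ?G" "satisfies \<mu> ?G" "\<forall>z\<in>V. \<nu> z = \<mu> z" for \<nu> \<mu>
      using that G d by simp
  qed
qed

section \<open>Termination and correctness of the two loops\<close>

lemma process_clause_short: "length C \<le> 2 \<Longrightarrow> process_clause C (i, M) = Some (i, M @ [C])"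
  by (simp add: process_clause_def while_option_unfold)

lemma process_clause_long:
  "Ls \<noteq> [] \<Longrightarrow> process_clause (L1 # L2 # Ls) (i, M) = process_clause ([Pos (Y (i + 1))] # Ls)
    (i + 1, M @ [[[Pos (Y (i + 1))], neg_lineral L2], [neg_lineral (Pos (Y (i + 1)) # L1), L2]])"
  unfolding process_clause_def
  by (simp add: while_option_unfold[of _ _ "(i, L1 # L2 # Ls, M)"] split_step_def Let_def)

text \<open>Induction on the clause length: one iteration trades two linerals for one.
  \<open>R\<close> stands for the clauses still waiting, which the inner loop never touches;
  carrying it along lets the result be used inside the whole formula.\<close>

lemma process_clause_correct:
  assumes "A \<inter> range Y = {}" and "vars (C # M @ R) \<subseteq> A \<union> Y ` {1..i}"
    and "\<forall>L\<in>set C. L \<noteq> []" and "is_k_xnf 2 M"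
  shows "\<exists>i' M'. process_clause C (i, M) = Some (i', M') \<and> is_k_xnf 2 M'
    \<and> unique_ext (A \<union> Y ` {1..i}) (C # M @ R) (A \<union> Y ` {1..i'}) (M' @ R)"
  using assms(2-)
proof (induction "length C" arbitrary: C i M rule: less_induct)
  case less
  show ?case
  proof (cases "length C \<le> 2")
    case True
    have "unique_ext (A \<union> Y ` {1..i}) (C # M @ R) (A \<union> Y ` {1..i}) ((M @ [C]) @ R)"
      using less.prems(1) by (intro unique_ext_refl) auto
    moreover have "is_k_xnf 2 (M @ [C])"
      using less.prems True by (auto simp: is_k_xnf_def is_xnf_def)
    ultimately show ?thesis using process_clause_short[OF True] by blast
  next
    case False
    then obtain L1 L2 Ls where C: "C = L1 # L2 # Ls" and Ls: "Ls \<noteq> []"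
      \<comment> \<open>This rule separates lists with zero, one and at least two entries.\<close>
      by (cases C rule: remdups_adj.cases) auto
    define y where "y = Y (i + 1)"
    define N where "N = [[[Pos y], neg_lineral L2], [neg_lineral (Pos y # L1), L2]]"
    let ?V = "A \<union> Y ` {1..i}" and ?W = "A \<union> Y ` {1..i + 1}" and ?C = "[Pos y] # Ls"
    have W: "?W = insert y ?V"
      by (auto simp: y_def atLeastAtMostSuc_conv)
    have L2: "L2 \<noteq> []" using less.prems(2) C by simp
    \<comment> \<open>Fresh because \<open>i + 1\<close> exceeds all indices used so far and
      \<open>A\<close> contains no \<open>Y\<close> variable.\<close>
    have "y \<notin> ?V" using assms(1) by (auto simp: y_def)
    then have "unique_ext ?V (C # M @ R) ?W (?C # N @ M @ R)"
      using unique_ext_split[of y ?V L1 L2 Ls "M @ R"] less.prems(1) L2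
      unfolding W C N_def by simp
    \<comment> \<open>The splitting lemma puts the new clauses before \<open>M\<close>, the
      procedure after it.\<close>
    moreover from this have "unique_ext ?W (?C # N @ M @ R) ?W (?C # (M @ N) @ R)"
      by (intro unique_ext_refl) (auto simp: unique_ext_def)
    ultimately have ext: "unique_ext ?V (C # M @ R) ?W (?C # (M @ N) @ R)"
      by (rule unique_ext_trans)
    have "\<exists>i' M'. process_clause ?C (i + 1, M @ N) = Some (i', M') \<and> is_k_xnf 2 M'
      \<and> unique_ext ?W (?C # (M @ N) @ R) (A \<union> Y ` {1..i'}) (M' @ R)"
    proof (rule less.hyps)
      show "length ?C < length C" by (simp add: C)
      show "vars (?C # (M @ N) @ R) \<subseteq> ?W" using ext by (simp add: unique_ext_def)
      show "\<forall>L\<in>set ?C. L \<noteq> []" using less.prems(2) by (simp add: C)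
      show "is_k_xnf 2 (M @ N)"
        using less.prems(3) L2 by (auto simp: is_k_xnf_def is_xnf_def N_def)
    qed
    moreover have "process_clause C (i, M) = process_clause ?C (i + 1, M @ N)"
      using process_clause_long[OF Ls] unfolding C N_def y_def .
    ultimately show ?thesis using unique_ext_trans[OF ext] by metis
  qed
qed

text \<open>The invariant formula consists of the unprocessed clauses and those collected so far.
  Each clause is handled with the later ones as \<open>R\<close>.\<close>

lemma process_clauses_correct:
  assumes "A \<inter> range Y = {}" and "vars (Cs @ M) \<subseteq> A \<union> Y ` {1..i}"
    and "is_xnf Cs" and "is_k_xnf 2 M"
  shows "\<exists>i' M'. process_clauses Cs (i, M) = Some (i', M') \<and> is_k_xnf 2 M'
    \<and> unique_ext (A \<union> Y ` {1..i}) (Cs @ M) (A \<union> Y ` {1..i'}) M'"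
  using assms(2-)
proof (induction Cs arbitrary: i M)
  case Nil
  then show ?case using unique_ext_refl[of M "A \<union> Y ` {1..i}" M] by simp
next
  case (Cons C Cs)
  let ?V = "\<lambda>i. A \<union> Y ` {1..i}"
  have "vars (C # M @ Cs) \<subseteq> ?V i" "\<forall>L\<in>set C. L \<noteq> []" "is_xnf Cs"
    using Cons.prems by (auto simp: vars_def is_xnf_def)
  then obtain j N where N: "process_clause C (i, M) = Some (j, N)" "is_k_xnf 2 N"
      "unique_ext (?V i) (C # M @ Cs) (?V j) (N @ Cs)"
    using process_clause_correct[OF assms(1)] Cons.prems(3) by metis
  have vars: "vars (Cs @ N) \<subseteq> ?V j" using N(3) by (auto simp: unique_ext_def)
  obtain i' M' where M': "process_clauses Cs (j, N) = Some (i', M')" "is_k_xnf 2 M'"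
      "unique_ext (?V j) (Cs @ N) (?V i') M'"
    using Cons.IH[OF vars \<open>is_xnf Cs\<close> N(2)] by metis
  have "unique_ext (?V i) ((C # Cs) @ M) (?V i) (C # M @ Cs)"
    using Cons.prems(1) by (intro unique_ext_refl) auto
  moreover have "unique_ext (?V j) (N @ Cs) (?V j) (Cs @ N)"
    using vars by (intro unique_ext_refl) auto
  ultimately have "unique_ext (?V i) ((C # Cs) @ M) (?V i') M'"
    using N(3) M'(3) by (blast intro: unique_ext_trans)
  then show ?case using N(1) M'(1,2) by simp
qed

section \<open>From assignments to points of the solution sets\<close>

abbreviation assignment :: "'v list \<Rightarrow> bit list \<Rightarrow> 'v \<Rightarrow> bit" where
  "assignment Zs a \<equiv> \<lambda>z. the (map_of (zip Zs a) z)"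

lemma map_assignment:
  "distinct Zs \<Longrightarrow> length a = length Zs \<Longrightarrow> map (assignment Zs a) Zs = a"
  by (rule nth_equalityI) (auto simp: map_of_zip_nth)

lemma assignment_map: "z \<in> set Zs \<Longrightarrow> assignment Zs (map \<nu> Zs) z = \<nu> z"
  by (simp add: map_of_zip_map)

lemma assignment_append:
  assumes "z \<in> set Zs" and "length Zs \<le> length b"
  shows "assignment (Zs @ Ws) b z = assignment Zs (take (length Zs) b) z"
proof -
  \<comment> \<open>Being in this domain, \<open>z\<close> is looked up in the first block and never
    in that of \<open>Ws\<close>.\<close>
  have "z \<in> dom (map_of (zip Zs (take (length Zs) b)))"
    using assms by (simp add: dom_map_of_zip)
  then show ?thesis by (auto simp: zip_append1 map_add_def)
qed

text \<open>Uniqueness gives injectivity, soundness shows that projections solve \<open>F\<close>,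
  and existence gives surjectivity. \<open>satisfies_cong\<close> absorbs the unspecified values of
  \<open>assignment\<close> off the listed variables.\<close>

lemma bij_betw_take_sat_set:
  assumes distinct: "distinct (Zs @ Ws)" and ext: "unique_ext (set Zs) F (set (Zs @ Ws)) G"
  shows "bij_betw (take (length Zs)) (sat_set (Zs @ Ws) G) (sat_set Zs F)"
proof (rule bij_betw_imageI)
  let ?p = "take (length Zs)" and ?as = "assignment (Zs @ Ws)"
  have vars: "vars F \<subseteq> set Zs" "vars G \<subseteq> set (Zs @ Ws)"
    using ext by (simp_all add: unique_ext_def)
  show "inj_on ?p (sat_set (Zs @ Ws) G)"
  proof (rule inj_onI)
    fix b c
    assume b: "b \<in> sat_set (Zs @ Ws) G" and c: "c \<in> sat_set (Zs @ Ws) G" and eq: "?p b = ?p c"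
    have "\<forall>z\<in>set Zs. ?as b z = ?as c z"
      using b c eq by (simp add: sat_set_def assignment_append)
    moreover have "satisfies (?as b) G" "satisfies (?as c) G"
      using b c by (simp_all add: sat_set_def)
    ultimately have "\<forall>z\<in>set (Zs @ Ws). ?as b z = ?as c z"
      using ext unfolding unique_ext_def by blast
    then have "map (?as b) (Zs @ Ws) = map (?as c) (Zs @ Ws)"
      by (intro map_cong) auto
    moreover have "map (?as b) (Zs @ Ws) = b" "map (?as c) (Zs @ Ws) = c"
      using b c map_assignment[OF distinct] unfolding sat_set_def by blast+
    ultimately show "b = c" by metis
  qed
  show "?p ` sat_set (Zs @ Ws) G = sat_set Zs F"
  proof (intro equalityI subsetI)
    fix a assume "a \<in> ?p ` sat_set (Zs @ Ws) G"
    then obtain b where b: "b \<in> sat_set (Zs @ Ws) G" and a: "a = ?p b" by blast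
    then have len: "length b = length (Zs @ Ws)" and "satisfies (?as b) F"
      using ext by (auto simp: sat_set_def unique_ext_def)
    moreover have "?as b z = assignment Zs a z" if "z \<in> vars F" for z
      using that vars(1) len assignment_append[of z Zs b Ws] by (auto simp: a)
    ultimately show "a \<in> sat_set Zs F"
      using satisfies_cong[of F "?as b" "assignment Zs a"] by (simp add: sat_set_def a)
  next
    fix a assume a: "a \<in> sat_set Zs F"
    then obtain \<mu> where \<mu>: "satisfies \<mu> G" "\<forall>z\<in>set Zs. \<mu> z = assignment Zs a z"
      using ext unfolding unique_ext_def sat_set_def by blast
    \<comment> \<open>The preimage of \<open>a\<close> lists the values of the extension
      \<open>\<mu>\<close> in coordinate order.\<close>
    let ?b = "map \<mu> (Zs @ Ws)"
    have "?as ?b z = \<mu> z" if "z \<in> vars G" for z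
      using that vars(2) by (intro assignment_map) blast
    then have "satisfies (?as ?b) G"
      using \<mu>(1) satisfies_cong[of G "?as ?b" \<mu>] by blast
    then have "?b \<in> sat_set (Zs @ Ws) G" by (simp add: sat_set_def)
    moreover have "map (assignment Zs a) Zs = a"
      using a distinct by (intro map_assignment) (auto simp: sat_set_def)
    then have "map \<mu> Zs = a" using \<mu>(2) by (metis map_cong)
    then have "?p ?b = a" by auto
    ultimately show "a \<in> ?p ` sat_set (Zs @ Ws) G" by (metis image_eqI)
  qed
qed

theorem proposition3p7:
  fixes n :: nat and F :: "var xnf"
  assumes "is_xnf F" and "vars F \<subseteq> X ` {1..n}"
  shows "\<exists>G m. XNFto2XNF F = Some G
    \<and> is_k_xnf 2 G
    \<and> vars G \<subseteq> X ` {1..n} \<union> Y ` {1..m}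
    \<and> proj_equiv n (sat_set (map X [1..<n+1]) F)
                    (sat_set (map X [1..<n+1] @ map Y [1..<m+1]) G)"
proof -
  have "X ` {1..n} \<inter> range Y = {}" by auto
  \<comment> \<open>The counter starts at 0, where \<open>{1..0}\<close> is empty: no
    \<open>Y\<close> variable is in use yet.\<close>
  moreover have "vars (F @ []) \<subseteq> X ` {1..n} \<union> Y ` {1..0}"
    using assms(2) by (auto simp: vars_def)
  ultimately obtain m G where G: "process_clauses F (0, []) = Some (m, G)" "is_k_xnf 2 G"
      and ext: "unique_ext (X ` {1..n}) F (X ` {1..n} \<union> Y ` {1..m}) G"
    using process_clauses_correct[of "X ` {1..n}" F "[]" 0] assms(1)
    by (auto simp: is_k_xnf_def is_xnf_def)
  let ?Zs = "map X [1..<n+1]" and ?Ws = "map Y [1..<m+1]"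
  have sets: "set ?Zs = X ` {1..n}" "set (?Zs @ ?Ws) = X ` {1..n} \<union> Y ` {1..m}"
    by (auto simp: atLeastLessThanSuc_atLeastAtMost simp del: upt_Suc)
  have "distinct (?Zs @ ?Ws)"
    by (auto simp: distinct_map inj_on_def simp del: upt_Suc)
  moreover have "unique_ext (set ?Zs) F (set (?Zs @ ?Ws)) G"
    using ext unfolding sets .
  ultimately have "bij_betw (take (length ?Zs)) (sat_set (?Zs @ ?Ws) G) (sat_set ?Zs F)"
    by (rule bij_betw_take_sat_set)
  moreover have "length ?Zs = n" by simp
  ultimately have "proj_equiv n (sat_set ?Zs F) (sat_set (?Zs @ ?Ws) G)"
    unfolding proj_equiv_def by metis
  moreover have "vars G \<subseteq> X ` {1..n} \<union> Y ` {1..m}"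
    using ext by (simp add: unique_ext_def)
  ultimately show ?thesis using G by (intro exI[of _ G] exI[of _ m]) (simp add: XNFto2XNF_def)
qed

end
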